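(* Let $n$, $l$, and $t$ be non-negative integers such that $t\leq n$. Then $$\sum_{k=t}^{2n-t}(-1)^k\binom{2n-2t}{k-t}S(k,l)\,S(2n-k,l)=(-1)^t\,\frac{\binom{2l}{l}\binom{2t}{t}\binom{2(n+l-t)}{n+l-t}\binom{2n}{n}\binom{2n-2t}{n-t}}{\binom{n+l}{n}\binom{2n+l-t}{n}\binom{n}{t}}.$$
   Context: For non-negative integers $a$ and $b$, the super Catalan number is $S(a,b)=\dfrac{\binom{2a}{a}\binom{2b}{b}}{\binom{a+b}{a}}=\dfrac{(2a)!\,(2b)!}{a!\,b!\,(a+b)!}$; it is always an integer. *)

theory Defs
  imports Complex_Main
begin

definition super_catalan :: "nat \<Rightarrow> nat \<Rightarrow> rat" where
  "super_catalan a b =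
     of_nat ((2 * a) choose a) * of_nat ((2 * b) choose b) / of_nat ((a + b) choose a)"

lemma super_catalan_fact:
  "super_catalan a b = fact (2 * a) * fact (2 * b) / (fact a * fact b * fact (a + b))"
proof -
  have c: "of_nat ((2 * a) choose a) = (fact (2 * a) / (fact a * fact a) :: rat)" for a
    using binomial_fact[of a "2 * a", where 'a = rat] by simp
  have d: "of_nat ((a + b) choose a) = (fact (a + b) / (fact a * fact b) :: rat)"
    using binomial_fact[of a "a + b", where 'a = rat] by simp
  show ?thesis
    unfolding super_catalan_def c d by (simp add: divide_simps)
qed

lemma super_catalan_Suc_right:
  "super_catalan a (Suc b) = 4 * super_catalan a b - super_catalan (Suc a) b"
proof -
  define s where "s = super_catalan a b"
  have nz: "of_nat (Suc (a + b)) \<noteq> (0 :: rat)" "of_nat (Suc a) \<noteq> (0 :: rat)"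
      "of_nat (Suc b) \<noteq> (0 :: rat)"
    by (simp_all only: of_nat_eq_0_iff)
  have f2: "(fact (2 * Suc m) :: rat) = 2 * of_nat (Suc m) * of_nat (2 * m + 1) * fact (2 * m)" for m
    by (simp add: algebra_simps)
  have l: "super_catalan (Suc a) b = s * (2 * of_nat (2 * a + 1) / of_nat (Suc (a + b)))"
    unfolding s_def super_catalan_fact f2 add_Suc fact_Suc using nz
    by (simp add: divide_simps del: of_nat_Suc fact_Suc)
  have r: "super_catalan a (Suc b) = s * (2 * of_nat (2 * b + 1) / of_nat (Suc (a + b)))"
    unfolding s_def super_catalan_fact f2 add_Suc_right fact_Suc using nz
    by (simp add: divide_simps del: of_nat_Suc fact_Suc)
  have "2 * of_nat (2 * b + 1) / of_nat (Suc (a + b))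
      = (4 - 2 * of_nat (2 * a + 1) / of_nat (Suc (a + b)) :: rat)"
    using nz(1) by (simp add: field_simps)
  then show ?thesis
    unfolding l r s_def[symmetric] by (simp add: right_diff_distrib)
qed

lemma super_catalan_in_Ints: "super_catalan a b \<in> \<int>"
proof (induction b arbitrary: a)
  case 0
  show ?case by (simp add: super_catalan_def)
next
  case (Suc b)
  show ?case unfolding super_catalan_Suc_right
    by (intro Ints_diff Ints_mult Suc.IH) simp
qed

end

(* Put m = n - t and write the sum as F(t, m), the sum over p of
   (-1)^p (2m choose p) S(t + p, l) S(t + 2m - p, l).  It is a terminating well-poised 3F2(1),
   evaluated here by creative telescoping at fixed n: passing from (t + 1, m) to (t, m + 1) keeps
   n = t + m, hence the product of super Catalan numbers, and changes only the binomial coefficient.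
   A Gosper certificate then gives a first-order recurrence relating F(t, m + 1) to F(t + 1, m), and
   F(t, 0) = S(t, l)^2 starts the induction. *)
theory Submission
  imports Defs
begin

lemma super_catalan_Suc_left:
  "of_nat (Suc (a + b)) * super_catalan (Suc a) b = 2 * of_nat (2 * a + 1) * super_catalan a b"
proof -
  have nz: "of_nat (Suc (a + b)) \<noteq> (0 :: rat)" "of_nat (Suc a) \<noteq> (0 :: rat)"
    by (simp_all only: of_nat_eq_0_iff)
  have f2: "(fact (2 * Suc a) :: rat) = 2 * of_nat (Suc a) * of_nat (2 * a + 1) * fact (2 * a)"
    by (simp add: algebra_simps)
  show ?thesis
    unfolding super_catalan_fact f2 add_Suc fact_Suc using nz
    by (simp add: divide_simps del: of_nat_Suc fact_Suc)
qed

text \<open>Only the two indices matter, so \<open>sc_prod l t (N + 2) (Suc p)\<close> agrees with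
  \<open>sc_prod l (Suc t) N p\<close>; this links neighbouring sums.\<close>

definition sc_prod :: "nat \<Rightarrow> nat \<Rightarrow> nat \<Rightarrow> nat \<Rightarrow> rat" where
  "sc_prod l t N p = super_catalan (t + p) l * super_catalan (t + N - p) l"

text \<open>Raising the first index multiplies by the ratio from
  \<open>super_catalan_Suc_left\<close>, lowering the second divides by its own ratio, and the
  factors 2 cancel. The complement \<open>q\<close> avoids truncated subtraction, and
  \<open>0 < q\<close> makes the second index \<open>t + q\<close> a successor.\<close>

lemma sc_prod_Suc:
  assumes "p + q = N" "0 < q"
  shows "of_nat (t + p + l + 1) * (2 * of_nat (t + q) - 1) * sc_prod l t N (Suc p)
       = of_nat (2 * (t + p) + 1) * of_nat (t + q + l) * sc_prod l t N p"
proof -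
  obtain r where r: "q = Suc r"
    using assms(2) by (cases q) auto
  have e: "t + N - p = Suc (t + r)" "t + N - Suc p = t + r"
    using assms r by auto
  have 1: "of_nat (t + p + l + 1) * super_catalan (Suc (t + p)) l
      = 2 * of_nat (2 * (t + p) + 1) * super_catalan (t + p) l"
    using super_catalan_Suc_left[of "t + p" l] by simp
  have 2: "of_nat (t + q + l) * super_catalan (Suc (t + r)) l
      = 2 * (2 * of_nat (t + q) - 1) * super_catalan (t + r) l"
    using super_catalan_Suc_left[of "t + r" l] by (simp add: r algebra_simps)
  have "of_nat (t + p + l + 1) * (2 * of_nat (t + q) - 1) * sc_prod l t N (Suc p)
      = (of_nat (t + p + l + 1) * super_catalan (Suc (t + p)) l)
        * ((2 * of_nat (t + q) - 1) * super_catalan (t + r) l)"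
    by (simp add: sc_prod_def e)
  also have "\<dots> = (of_nat (2 * (t + p) + 1) * super_catalan (t + p) l)
        * (2 * (2 * of_nat (t + q) - 1) * super_catalan (t + r) l)"
    unfolding 1 by (simp only: mult_ac)
  also have "\<dots> = of_nat (2 * (t + p) + 1) * of_nat (t + q + l) * sc_prod l t N p"
    unfolding 2[symmetric] by (simp add: sc_prod_def e)
  finally show ?thesis .
qed

definition alt_sum :: "nat \<Rightarrow> nat \<Rightarrow> nat \<Rightarrow> rat" where
  "alt_sum l t m = (\<Sum>p\<le>2 * m. (-1) ^ p * of_nat ((2 * m) choose p) * sc_prod l t (2 * m) p)"

text \<open>Gosper antidifference: the summand times a polynomial in \<open>p\<close>. The factor
  \<open>p\<close> makes it vanish at \<open>p = 0\<close>, the binomial coefficient at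
  \<open>p = N + 1\<close>.\<close>

definition certificate :: "nat \<Rightarrow> nat \<Rightarrow> nat \<Rightarrow> nat \<Rightarrow> rat" where
  "certificate l t N p = - ((-1) ^ p * of_nat (p * (N choose p)) * sc_prod l t N p
     * of_nat (t + p + l) * (2 * (of_nat (t + N) - of_nat p) + 1))"

lemma certificate_Suc:
  assumes "p + q = N"
  shows "certificate l t N (Suc p) = (-1) ^ p * of_nat (q * (N choose p)) * sc_prod l t N p
     * of_nat (2 * (t + p) + 1) * of_nat (t + q + l)"
\<comment> \<open>At \<open>q = 0\<close>, where \<open>sc_prod_Suc\<close> does not apply, both
  sides vanish because \<open>N choose Suc N = 0\<close>.\<close>
proof (cases "q = 0")
  case True
  then show ?thesis using assms by (simp add: certificate_def binomial_eq_0)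
next
  case False
  have N: "of_nat (t + N) - of_nat (Suc p) = (of_nat (t + q) - 1 :: rat)"
    using assms by auto
  have b: "Suc p * (N choose Suc p) = q * (N choose p)"
    using binomial_absorb_comp[of N p] binomial_absorption[of p N] assms by auto
  have "certificate l t N (Suc p) = (-1) ^ p * of_nat (q * (N choose p))
      * (of_nat (t + p + l + 1) * (2 * of_nat (t + q) - 1) * sc_prod l t N (Suc p))"
    unfolding certificate_def N b by (simp add: algebra_simps)
  then show ?thesis
    unfolding sc_prod_Suc[OF assms(1) False[unfolded neq0_conv]] by (simp add: mult.assoc)
qed

text \<open>The coefficient has a part free of \<open>p\<close>, which yields the sum at
  \<open>(t, M)\<close>, and a multiple of \<open>p * q\<close>, which
  \<open>sum_choose_shift\<close> turns into the sum at \<open>(t + 1, M - 1)\<close>.\<close>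

lemma telescoping:
  assumes "p + q = 2 * M"
  shows "((2 * of_nat t + 1) * of_nat (t + 2 * M + l) * (2 * of_nat M)
        + 2 * (2 * of_nat (M + l) - 1) * of_nat (p * q))
        * ((-1) ^ p * of_nat ((2 * M) choose p) * sc_prod l t (2 * M) p)
      = certificate l t (2 * M) (Suc p) - certificate l t (2 * M) p"
proof -
  define x where "x = (-1) ^ p * of_nat ((2 * M) choose p) * sc_prod l t (2 * M) p"
  have N: "of_nat (2 * M) = (of_nat p + of_nat q :: rat)"
    using arg_cong[OF assms, of "of_nat :: nat \<Rightarrow> rat"] by simp
  then have M: "of_nat M = ((of_nat p + of_nat q) / 2 :: rat)"
    by simp
  have 1: "certificate l t (2 * M) (Suc p)
      = x * (of_nat q * of_nat (2 * (t + p) + 1) * of_nat (t + q + l))"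
    unfolding certificate_Suc[OF assms] x_def by simp
  have 2: "certificate l t (2 * M) p
      = - (x * (of_nat p * of_nat (t + p + l) * (2 * (of_nat t + of_nat q) + 1)))"
    unfolding certificate_def x_def of_nat_add N by simp
  \<comment> \<open>Every term carries the factor \<open>x\<close>; once \<open>M\<close> is
    replaced by \<open>(p + q) / 2\<close>, a polynomial identity in \<open>p\<close>,
    \<open>q\<close>, \<open>t\<close>, \<open>l\<close> remains.\<close>
  show ?thesis
    unfolding 1 2 x_def[symmetric] of_nat_add of_nat_mult M
    by (simp add: field_simps)
qed

text \<open>Absorbing twice gives \<open>p (N - p) C(N, p) = N (N - 1) C(N - 2, p - 1)\<close>;
  shifting \<open>p\<close> by one then costs a sign and trades \<open>t\<close> for
  \<open>Suc t\<close>.\<close>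

lemma sum_choose_shift:
  "(\<Sum>p\<le>2 * Suc m. of_nat (p * (2 * Suc m - p))
        * ((-1) ^ p * of_nat ((2 * Suc m) choose p) * sc_prod l t (2 * Suc m) p))
   = - (of_nat (2 * Suc m) * of_nat (2 * m + 1) * alt_sum l (Suc t) m)"
proof -
  let ?f = "\<lambda>p. of_nat (p * (2 * Suc m - p))
        * ((-1) ^ p * of_nat ((2 * Suc m) choose p) * sc_prod l t (2 * Suc m) p)"
  have s: "?f (Suc p) = - (of_nat (2 * Suc m) * of_nat (2 * m + 1)
      * ((-1) ^ p * of_nat ((2 * m) choose p) * sc_prod l (Suc t) (2 * m) p))"
    if "p \<le> 2 * m" for p
  proof -
    have e: "sc_prod l t (2 * Suc m) (Suc p) = sc_prod l (Suc t) (2 * m) p"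
      using that by (simp add: sc_prod_def)
    have "Suc p * (2 * Suc m - Suc p) * ((2 * Suc m) choose Suc p)
        = (Suc (2 * m) - p) * (Suc p * (Suc (Suc (2 * m)) choose Suc p))"
      unfolding mult_Suc_right[of 2 m] by (simp only: add_2_eq_Suc diff_Suc_Suc mult_ac)
    also have "\<dots> = Suc (Suc (2 * m)) * ((Suc (2 * m) - p) * (Suc (2 * m) choose p))"
      by (simp only: binomial_absorption diff_Suc_1 mult.left_commute)
    also have "\<dots> = 2 * Suc m * (2 * m + 1) * ((2 * m) choose p)"
      unfolding binomial_absorb_comp by (simp add: algebra_simps)
    finally have b: "Suc p * (2 * Suc m - Suc p) * ((2 * Suc m) choose Suc p)
        = 2 * Suc m * (2 * m + 1) * ((2 * m) choose p)" .
    have "?f (Suc p) = - ((-1) ^ p * sc_prod l (Suc t) (2 * m) p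
        * of_nat (Suc p * (2 * Suc m - Suc p) * ((2 * Suc m) choose Suc p)))"
      unfolding e of_nat_mult by simp
    then show ?thesis
      unfolding b of_nat_mult by simp
  qed
  \<comment> \<open>The weight vanishes at both ends, so the last term is dropped here and the term
    at 0 by the shift.\<close>
  have "(\<Sum>p\<le>2 * Suc m. ?f p) = (\<Sum>p\<le>Suc (2 * m). ?f p)"
    by simp
  also have "\<dots> = (\<Sum>p\<le>2 * m. ?f (Suc p))"
    by (subst sum.atMost_Suc_shift) simp
  also have "\<dots> = - (of_nat (2 * Suc m) * of_nat (2 * m + 1) * alt_sum l (Suc t) m)"
    unfolding alt_sum_def sum_distrib_left sum_negf[symmetric]
    by (intro sum.cong refl s) simp
  finally show ?thesis .
qed

lemma alt_sum_rec:
  "of_nat (2 * t + 1) * of_nat (t + 2 * m + 2 + l) * alt_sum l t (Suc m)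
   = 2 * of_nat (2 * m + 2 * l + 1) * of_nat (2 * m + 1) * alt_sum l (Suc t) m"
proof -
  let ?N = "2 * Suc m"
  let ?x = "\<lambda>p. (-1) ^ p * of_nat (?N choose p) * sc_prod l t ?N p"
  let ?A = "(2 * of_nat t + 1) * of_nat (t + ?N + l) * (2 * of_nat (Suc m)) :: rat"
  let ?B = "2 * (2 * of_nat (Suc m + l) - 1) :: rat"
  have "?A * alt_sum l t (Suc m) + ?B * (\<Sum>p\<le>?N. of_nat (p * (?N - p)) * ?x p)
      = (\<Sum>p\<le>?N. (?A + ?B * of_nat (p * (?N - p))) * ?x p)"
    unfolding alt_sum_def sum_distrib_left sum.distrib[symmetric] by (simp only: ring_distribs mult.assoc)
  also have "\<dots> = (\<Sum>p\<le>?N. certificate l t ?N (Suc p) - certificate l t ?N p)"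
    by (intro sum.cong refl telescoping) simp
  also have "\<dots> = certificate l t ?N (Suc ?N) - certificate l t ?N 0"
    by (simp only: sum_lessThan_telescope flip: lessThan_Suc_atMost)
  \<comment> \<open>The upper end vanishes by \<open>?N choose Suc ?N = 0\<close>, the lower one by
    the factor \<open>p\<close>.\<close>
  also have "\<dots> = 0"
    by (simp add: certificate_def binomial_eq_0 del: binomial_Suc_Suc)
  finally have *: "?A * alt_sum l t (Suc m)
      = ?B * (of_nat (2 * Suc m) * of_nat (2 * m + 1) * alt_sum l (Suc t) m)"
    unfolding sum_choose_shift by simp
  \<comment> \<open>Both coefficients contain \<open>2 * Suc m\<close>, on the right as the
    \<open>N\<close> from absorption; it is cancelled at the end.\<close>
  have "2 * of_nat (Suc m) * (of_nat (2 * t + 1) * of_nat (t + 2 * m + 2 + l) * alt_sum l t (Suc m))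
      = ?A * alt_sum l t (Suc m)"
    by (simp add: mult_ac add_ac)
  also have "\<dots> = 2 * of_nat (Suc m)
      * (2 * of_nat (2 * m + 2 * l + 1) * of_nat (2 * m + 1) * alt_sum l (Suc t) m)"
    unfolding * by (simp add: algebra_simps)
  finally show ?thesis
    by (simp only: mult_cancel_left) simp
qed

text \<open>The claimed value at \<open>n = t + m\<close> without its sign, in factorials so that
  quotients of neighbouring values simplify.\<close>

definition closed_form :: "nat \<Rightarrow> nat \<Rightarrow> nat \<Rightarrow> rat" where
  "closed_form l t m =
     fact (2 * l) * fact (2 * t) * fact (2 * (m + l)) * fact (2 * (t + m)) * fact (2 * m)
     / (fact l * fact t * fact (m + l) * fact m * fact (t + m + l) * fact (t + 2 * m + l)
        * fact (t + m))"

text \<open>The factorials of \<open>t + m\<close>, \<open>2 * (t + m)\<close> and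
  \<open>t + m + l\<close> agree on both sides; the others change by linear factors, which produce
  the coefficients of \<open>alt_sum_rec\<close>.\<close>

lemma closed_form_rec:
  "of_nat (2 * t + 1) * of_nat (t + 2 * m + 2 + l) * closed_form l t (Suc m)
   = 2 * of_nat (2 * m + 2 * l + 1) * of_nat (2 * m + 1) * closed_form l (Suc t) m"
proof -
  have f2: "(fact (2 * Suc a) :: rat) = 2 * of_nat (Suc a) * of_nat (2 * a + 1) * fact (2 * a)" for a
    by (simp add: algebra_simps)
  have e: "2 * (Suc m + l) = 2 * Suc (m + l)" "t + 2 * Suc m + l = Suc (Suc t + 2 * m + l)"
    "Suc m + l = Suc (m + l)" "t + Suc m = Suc t + m" "2 * m + 2 * l = 2 * (m + l)"
    "t + 2 * m + 2 + l = Suc (Suc t + 2 * m + l)"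
    by simp_all
  have nz: "of_nat (Suc a) \<noteq> (0 :: rat)" for a
    by (simp only: of_nat_eq_0_iff)
  show ?thesis
    unfolding closed_form_def e f2 fact_Suc[of m] fact_Suc[of t] fact_Suc[of "m + l"]
      fact_Suc[of "Suc t + 2 * m + l"]
    using nz[of m] nz[of t] nz[of "m + l"] nz[of "Suc t + 2 * m + l"]
    by (simp add: divide_simps del: of_nat_Suc fact_Suc add_Suc)
qed

lemma alt_sum_eq: "alt_sum l t m = closed_form l t m"
\<comment> \<open>The recurrence lowers \<open>m\<close> but raises \<open>t\<close>, so
  \<open>t\<close> must vary.\<close>
proof (induction m arbitrary: t)
  case 0
  show ?case
    by (simp add: alt_sum_def sc_prod_def closed_form_def super_catalan_fact mult_ac)
next
  case (Suc m)
  have nz: "of_nat (2 * t + 1) * of_nat (t + 2 * m + 2 + l) \<noteq> (0 :: rat)"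
    by (simp only: mult_eq_0_iff of_nat_eq_0_iff) simp
  have "of_nat (2 * t + 1) * of_nat (t + 2 * m + 2 + l) * alt_sum l t (Suc m)
      = of_nat (2 * t + 1) * of_nat (t + 2 * m + 2 + l) * closed_form l t (Suc m)"
    unfolding alt_sum_rec closed_form_rec Suc.IH ..
  with nz show ?case
    by (simp only: mult_cancel_left) simp
qed

lemma closed_form_binomial:
  "closed_form l t m =
     of_nat ((2 * l) choose l) * of_nat ((2 * t) choose t) * of_nat ((2 * (m + l)) choose (m + l))
     * of_nat ((2 * (t + m)) choose (t + m)) * of_nat ((2 * m) choose m)
     / (of_nat ((t + m + l) choose (t + m)) * of_nat ((t + 2 * m + l) choose (t + m))
        * of_nat ((t + m) choose t))"
proof -
  have c: "of_nat ((2 * a) choose a) = (fact (2 * a) / (fact a * fact a) :: rat)" for a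
    using binomial_fact[of a "2 * a", where 'a = rat] by simp
  have d: "of_nat ((a + b) choose a) = (fact (a + b) / (fact a * fact b) :: rat)" for a b
    using binomial_fact[of a "a + b", where 'a = rat] by simp
  \<comment> \<open>This splitting brings the binomial coefficient of \<open>t + 2 * m + l\<close>
    over \<open>t + m\<close> into the shape of \<open>d\<close>.\<close>
  have e: "t + 2 * m + l = (t + m) + (m + l)"
    by simp
  show ?thesis
    unfolding closed_form_def c e d by (simp add: divide_simps)
qed

theorem theorem2:
  fixes n l t :: nat
  assumes "t \<le> n"
  shows "(\<Sum>k = t..2 * n - t.
            (-1) ^ k * of_nat ((2 * n - 2 * t) choose (k - t))
              * super_catalan k l * super_catalan (2 * n - k) l)
       = (-1) ^ t *
         (of_nat ((2 * l) choose l) * of_nat ((2 * t) choose t)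
            * of_nat ((2 * (n + l - t)) choose (n + l - t))
            * of_nat ((2 * n) choose n) * of_nat ((2 * n - 2 * t) choose (n - t))
          / (of_nat ((n + l) choose n) * of_nat ((2 * n + l - t) choose n) * of_nat (n choose t)))"
proof -
  obtain m where n: "n = t + m"
    using assms le_Suc_ex by blast
  have e: "2 * n - 2 * t = 2 * m" "n + l - t = m + l" "n - t = m" "2 * n + l - t = t + 2 * m + l"
    "n + l = t + m + l" "2 * n - t = 2 * m + t"
    using n by auto
  have "(\<Sum>k = t..2 * n - t. (-1) ^ k * of_nat ((2 * n - 2 * t) choose (k - t))
              * super_catalan k l * super_catalan (2 * n - k) l)
      = (\<Sum>k = 0 + t..2 * m + t. (-1) ^ k * of_nat ((2 * m) choose (k - t))
              * super_catalan k l * super_catalan (2 * n - k) l)"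
    unfolding e by simp
  \<comment> \<open>Substituting \<open>k = p + t\<close> extracts \<open>(-1) ^ t\<close> and turns
    the index \<open>2 * n - k\<close> into \<open>t + 2 * m - p\<close>.\<close>
  also have "\<dots> = (-1) ^ t * alt_sum l t m"
    unfolding sum.shift_bounds_cl_nat_ivl alt_sum_def sum_distrib_left atLeast0AtMost
    by (intro sum.cong refl) (simp add: sc_prod_def n power_add algebra_simps)
  finally show ?thesis
    unfolding alt_sum_eq closed_form_binomial e(1-4) unfolding e(5,6) by (simp only: n)
qed

end
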